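(* Assume $\sigma_k>\sigma_{k+1}$. Let $\mathsf C_\ell,\mathsf C_u>0$ be the costs per labeled and per unlabeled sample and $\mathsf C>0$ the total sampling budget. Given the budget constraint $n_\ell\mathsf C_\ell+n_u\mathsf C_u\le\mathsf C$, the numbers of labeled samples $n_\ell$ and unlabeled samples $n_u$ that optimize the sample complexity of estimating the $k$-dimensional maximal correlation functions, i.e. that maximize the error exponent $$\frac{\epsilon\, n_\ell}{2\bar\alpha_k(r)},\qquad r=\frac{n_u}{n_\ell},$$ (for $\epsilon>0$, with $n_\ell>0,\ n_u\ge0$ treated as real numbers) are $$n_\ell=\frac{\mathsf C}{\mathsf C_\ell+r^*\mathsf C_u},\qquad n_u=\frac{r^*\mathsf C}{\mathsf C_\ell+r^*\mathsf C_u},$$ where $$r^*=\operatorname*{arg\,min}_{r\ge0}\,(\mathsf C_\ell+r\mathsf C_u)\,\bar\alpha_k(r).$$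
   Context: Let $\mathcal X=\{1,\dots,|\mathcal X|\}$ and $\mathcal Y=\{1,\dots,|\mathcal Y|\}$ be finite alphabets and $P_{XY}$ a joint probability distribution on $\mathcal X\times\mathcal Y$ whose marginals satisfy $P_X(x)>0$, $P_Y(y)>0$ for all $x,y$. Let $d=|\mathcal X|$. The matrix $\tilde{\mathbf B}\in\mathbb R^{|\mathcal Y|\times|\mathcal X|}$ has entries $\tilde B(y,x)=\frac{P_{XY}(x,y)-P_X(x)P_Y(y)}{\sqrt{P_X(x)P_Y(y)}}$. Let $\sigma_1\ge\dots\ge\sigma_d\ge0$ be its singular values ($\sigma_i=0$ for $i>|\mathcal Y|$) and $\boldsymbol\phi_1,\dots,\boldsymbol\phi_d\in\mathbb R^d$ corresponding orthonormal right singular vectors; $k\in\{1,\dots,d-1\}$. Let $\mathbf L$ be the $(|\mathcal X||\mathcal Y|)\times(|\mathcal X||\mathcal Y|)$ matrix whose entry in row $(x-1)|\mathcal Y|+y$ and column $(x'-1)|\mathcal Y|+y'$ is $$\sqrt{\frac{P_{XY}(x',y')}{P_X(x)P_Y(y)}}\left[\delta_{xx'}\delta_{yy'}-\frac12\left(\frac{\delta_{xx'}}{P_X(x)}+\frac{\delta_{yy'}}{P_Y(y)}\right)\left(P_{XY}(x,y)+P_X(x)P_Y(y)\right)\right].$$ Let $\boldsymbol\theta_{ij}=\boldsymbol\phi_j\otimes(\tilde{\mathbf B}\boldsymbol\phi_i)+\boldsymbol\phi_i\otimes(\tilde{\mathbf B}\boldsymbol\phi_j)$ and $\mathbf G_k=\mathbf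 L^{\mathrm T}\left(\sum_{i=1}^k\sum_{j=k+1}^d\frac{\boldsymbol\theta_{ij}\boldsymbol\theta_{ij}^{\mathrm T}}{\sigma_i^2-\sigma_j^2}\right)\mathbf L$. For $r\ge0$ let $\bar{\mathbf L}(r)$ be the $(|\mathcal X||\mathcal Y|)\times[|\mathcal X|(|\mathcal Y|+1)]$ matrix whose entry in row $(x-1)|\mathcal Y|+y$ and column $(x'-1)|\mathcal Y|+y'$ is $\delta_{xx'}\delta_{yy'}-\frac r{1+r}\sqrt{P_{Y|X}(y|x)P_{Y|X}(y'|x')}\,\delta_{xx'}$, and whose entry in row $(x-1)|\mathcal Y|+y$ and column $|\mathcal X||\mathcal Y|+x'$ is $\frac{\sqrt r}{1+r}\sqrt{P_{Y|X}(y|x)}\,\delta_{xx'}$. Then $\bar\alpha_k(r)$ is the spectral norm of $\bar{\mathbf L}(r)^{\mathrm T}\mathbf G_k\bar{\mathbf L}(r)$. The quantity $\epsilon n_\ell/[2\bar\alpha_k(r)]$ is the (first-order) exponent of the probability that the learning error of the $k$-dimensional maximal correlation functions exceeds $\epsilon$, when $n_\ell$ labeled and $n_u=rn_\ell$ unlabeled samples are used; "optimal" means maximizing this quantity under the budget constraint. *)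

theory Defs
  imports "HOL-Probability.Probability"
begin

text \<open>
  Alphabets are finite types \<open>'x\<close> and \<open>'y\<close>. Vectors and matrices whose rows are numbered
  \<open>(x - 1)|Y| + y\<close> in the usual Kronecker convention are indexed by pairs \<open>(x, y)\<close> instead, and
  the additional columns \<open>|X||Y| + x'\<close> by the right summand of \<open>'x \<times> 'y + 'x\<close>.
  Singular values and vectors are numbered from 1.
\<close>

definition PX :: "('x \<times> 'y) pmf \<Rightarrow> 'x \<Rightarrow> real" where
  "PX P x = pmf (map_pmf fst P) x"

definition PY :: "('x \<times> 'y) pmf \<Rightarrow> 'y \<Rightarrow> real" where
  "PY P y = pmf (map_pmf snd P) y"

definition cond_prob_YX :: "('x \<times> 'y) pmf \<Rightarrow> 'y \<Rightarrow> 'x \<Rightarrow> real" where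
  "cond_prob_YX P y x = pmf P (x, y) / PX P x"

definition B_tilde :: "('x::finite \<times> 'y::finite) pmf \<Rightarrow> real ^ 'x ^ 'y" where
  "B_tilde P = (\<chi> y x. (pmf P (x, y) - PX P x * PY P y) / sqrt (PX P x * PY P y))"

definition outer :: "real ^ 'a \<Rightarrow> real ^ 'b \<Rightarrow> real ^ 'b ^ 'a" where
  "outer u v = (\<chi> i j. u $ i * v $ j)"

definition orthonormal_family :: "nat \<Rightarrow> (nat \<Rightarrow> real ^ 'a) \<Rightarrow> bool" where
  "orthonormal_family m v \<longleftrightarrow>
     (\<forall>i\<in>{1..m}. \<forall>j\<in>{1..m}. v i \<bullet> v j = (if i = j then 1 else 0))"

text \<open>
  \<open>\<sigma> 1 \<ge> \<dots> \<ge> \<sigma> d \<ge> 0\<close>, with \<open>d\<close> the number of columns of \<open>A\<close>, are the singular values of \<open>A\<close>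
  (padded with zeros if \<open>A\<close> has fewer rows than columns) and \<open>\<phi> 1, \<dots>, \<phi> d\<close> are corresponding
  orthonormal right singular vectors; the left singular vectors are the \<open>\<psi> i\<close>.
\<close>

definition singular_system ::
    "real ^ 'c ^ 'r \<Rightarrow> (nat \<Rightarrow> real) \<Rightarrow> (nat \<Rightarrow> real ^ 'c) \<Rightarrow> bool" where
  "singular_system A \<sigma> \<phi> \<longleftrightarrow>
     (\<forall>i\<in>{1..CARD('c)}. 0 \<le> \<sigma> i) \<and>
     (\<forall>i\<in>{1..CARD('c)}. \<forall>j\<in>{1..CARD('c)}. i \<le> j \<longrightarrow> \<sigma> j \<le> \<sigma> i) \<and>
     (\<forall>i\<in>{1..CARD('c)}. CARD('r) < i \<longrightarrow> \<sigma> i = 0) \<and>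
     orthonormal_family CARD('c) \<phi> \<and>
     (\<exists>\<psi>. orthonormal_family (min CARD('r) CARD('c)) \<psi> \<and>
          A = (\<Sum>i = 1..min CARD('r) CARD('c). \<sigma> i *\<^sub>R outer (\<psi> i) (\<phi> i)))"

definition kron_vec :: "real ^ 'x::finite \<Rightarrow> real ^ 'y::finite \<Rightarrow> real ^ ('x \<times> 'y)" where
  "kron_vec u w = (\<chi> p. u $ fst p * w $ snd p)"

definition L_mat :: "('x::finite \<times> 'y::finite) pmf \<Rightarrow> real ^ ('x \<times> 'y) ^ ('x \<times> 'y)" where
  "L_mat P = (\<chi> p q. case (p, q) of ((x, y), (x', y')) \<Rightarrow>
     sqrt (pmf P (x', y') / (PX P x * PY P y)) *
       (of_bool (x = x') * of_bool (y = y')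
        - 1 / 2 * (of_bool (x = x') / PX P x + of_bool (y = y') / PY P y)
            * (pmf P (x, y) + PX P x * PY P y)))"

definition theta ::
    "('x::finite \<times> 'y::finite) pmf \<Rightarrow> (nat \<Rightarrow> real ^ 'x) \<Rightarrow> nat \<Rightarrow> nat \<Rightarrow> real ^ ('x \<times> 'y)" where
  "theta P \<phi> i j =
     kron_vec (\<phi> j) (B_tilde P *v \<phi> i) + kron_vec (\<phi> i) (B_tilde P *v \<phi> j)"

definition G_mat ::
    "('x::finite \<times> 'y::finite) pmf \<Rightarrow> (nat \<Rightarrow> real) \<Rightarrow> (nat \<Rightarrow> real ^ 'x) \<Rightarrow> nat
      \<Rightarrow> real ^ ('x \<times> 'y) ^ ('x \<times> 'y)" where
  "G_mat P \<sigma> \<phi> k =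
     transpose (L_mat P) **
     (\<Sum>i = 1..k. \<Sum>j = k + 1..CARD('x).
        (1 / ((\<sigma> i)\<^sup>2 - (\<sigma> j)\<^sup>2)) *\<^sub>R outer (theta P \<phi> i j) (theta P \<phi> i j)) **
     L_mat P"

definition L_bar ::
    "('x::finite \<times> 'y::finite) pmf \<Rightarrow> real \<Rightarrow> real ^ ('x \<times> 'y + 'x) ^ ('x \<times> 'y)" where
  "L_bar P r = (\<chi> p c. case p of (x, y) \<Rightarrow> (case c of
       Inl (x', y') \<Rightarrow> of_bool (x = x') * of_bool (y = y')
          - r / (1 + r) * sqrt (cond_prob_YX P y x * cond_prob_YX P y' x') * of_bool (x = x')
     | Inr x' \<Rightarrow> sqrt r / (1 + r) * sqrt (cond_prob_YX P y x) * of_bool (x = x')))"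

definition spectral_norm :: "real ^ 'c ^ 'r \<Rightarrow> real" where
  "spectral_norm A = onorm (\<lambda>v. A *v v)"

definition alpha_bar ::
    "('x::finite \<times> 'y::finite) pmf \<Rightarrow> (nat \<Rightarrow> real) \<Rightarrow> (nat \<Rightarrow> real ^ 'x) \<Rightarrow> nat \<Rightarrow> real \<Rightarrow> real" where
  "alpha_bar P \<sigma> \<phi> k r =
     spectral_norm (transpose (L_bar P r) ** G_mat P \<sigma> \<phi> k ** L_bar P r)"

text \<open>
  In an allocation \<open>(nl, nu)\<close>, \<open>nl\<close> counts the labeled and \<open>nu\<close> the unlabeled samples.
\<close>

definition error_exponent ::
    "('x::finite \<times> 'y::finite) pmf \<Rightarrow> (nat \<Rightarrow> real) \<Rightarrow> (nat \<Rightarrow> real ^ 'x) \<Rightarrow> nat \<Rightarrow> real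
      \<Rightarrow> real \<times> real \<Rightarrow> real" where
  "error_exponent P \<sigma> \<phi> k \<epsilon> = (\<lambda>(nl, nu). \<epsilon> * nl / (2 * alpha_bar P \<sigma> \<phi> k (nu / nl)))"

definition within_budget :: "real \<Rightarrow> real \<Rightarrow> real \<Rightarrow> real \<times> real \<Rightarrow> bool" where
  "within_budget Cl Cu C = (\<lambda>(nl, nu). 0 < nl \<and> 0 \<le> nu \<and> nl * Cl + nu * Cu \<le> C)"

end

theory Submission
  imports Defs
begin

text \<open>
  For fixed \<open>r = nu / nl\<close> the exponent is proportional to \<open>nl\<close>, so the budget is exhausted at an
  optimum and what remains is to minimise \<open>(Cl + r * Cu) * alpha_bar r\<close>. Since division by zero
  yields zero, this rests on \<open>alpha_bar r > 0\<close> for all \<open>r \<ge> 0\<close>. The vector \<open>s = sqrt PX\<close> lies in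
  the kernel of \<open>B_tilde P\<close> and hence in the span of the \<open>\<phi> j\<close> with \<open>j > k\<close>, so
  \<open>kron_vec s (B_tilde P *v \<phi> 1)\<close> is a linear combination of the vectors \<open>theta P \<phi> 1 j\<close>. The vector
  \<open>w (x, y) = sqrt (P (x, y) / PX x) * \<phi> 1 x\<close> is an eigenvector of the left block of
  \<open>L_bar P r\<close> with eigenvalue \<open>1 / (1 + r)\<close>, and
  \<open>kron_vec s (B_tilde P *v \<phi> 1) \<bullet> (L_mat P *v w) = - (norm (B_tilde P *v \<phi> 1))\<^sup>2 / 2 \<noteq> 0\<close>.
\<close>

subsection \<open>Matrices and orthonormal systems\<close>

lemma outer_mult_vec: "outer u v *v w = (v \<bullet> w) *\<^sub>R u"
  by (simp add: vec_eq_iff outer_def matrix_vector_mult_def inner_vec_def sum_distrib_left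
      mult.commute mult.left_commute)

lemma sum_matrix_mult_vec:
  fixes A :: "'i \<Rightarrow> real ^ 'c ^ 'r"
  shows "(\<Sum>i\<in>I. A i) *v x = (\<Sum>i\<in>I. A i *v x)"
  by (induction I rule: infinite_finite_induct) (simp_all add: matrix_vector_mult_add_rdistrib)

lemma inner_congruence:
  fixes A :: "real ^ 'c ^ 'r" and G :: "real ^ 'r ^ 'r"
  shows "v \<bullet> ((transpose A ** G ** A) *v v) = (A *v v) \<bullet> (G *v (A *v v))"
  by (metis dot_lmul_matrix inner_commute matrix_vector_mul_assoc transpose_matrix_vector)

lemma sum_UNIV_prod: "(\<Sum>p\<in>UNIV. f p) = (\<Sum>x\<in>UNIV. \<Sum>y\<in>UNIV. f (x, y))"
  for f :: "'a::finite \<times> 'b::finite \<Rightarrow> 'c::comm_monoid_add"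
  by (simp add: sum.cartesian_product)

text \<open>Orthonormal vectors are independent, and \<open>CARD('a)\<close> of them span the space
  by dimension. The residual of the expansion lies in this span and is orthogonal to every
  \<open>v j\<close>, hence to itself.\<close>

lemma orthonormal_expansion:
  fixes v :: "nat \<Rightarrow> real ^ 'a"
  assumes "orthonormal_family CARD('a) v"
  shows "x = (\<Sum>i = 1..CARD('a). (v i \<bullet> x) *\<^sub>R v i)"
proof -
  let ?I = "{1..CARD('a)}"
  have on: "v i \<bullet> v j = (if i = j then 1 else 0)" if "i \<in> ?I" "j \<in> ?I" for i j
    using assms that by (auto simp: orthonormal_family_def)
  have inj: "inj_on v ?I"
    by (rule inj_onI) (metis on zero_neq_one)
  have "pairwise orthogonal (v ` ?I)"
    using on by (fastforce simp: pairwise_def orthogonal_def)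
  moreover have "0 \<notin> v ` ?I"
    using on by force
  ultimately have ind: "independent (v ` ?I)"
    by (rule pairwise_orthogonal_independent)
  have "card (v ` ?I) = dim (UNIV :: (real ^ 'a) set)"
    using inj by (simp add: card_image dim_UNIV)
  then have "UNIV \<subseteq> span (v ` ?I)"
    using ind by (intro card_ge_dim_independent) auto
  then have "x - (\<Sum>i\<in>?I. (v i \<bullet> x) *\<^sub>R v i) \<in> span (v ` ?I)" (is "?z \<in> _") by blast
  moreover have "orthogonal ?z b" if b: "b \<in> v ` ?I" for b
  proof -
    obtain j where j: "j \<in> ?I" "b = v j" using b by blast
    have "(\<Sum>i\<in>?I. (v i \<bullet> x) * (v i \<bullet> v j)) = (\<Sum>i\<in>?I. if i = j then v i \<bullet> x else 0)"
      using on j by (intro sum.cong) auto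
    also have "\<dots> = x \<bullet> v j"
      using j by (simp add: inner_commute)
    finally show ?thesis
      unfolding j(2) by (simp add: orthogonal_def inner_diff_left inner_sum_left)
  qed
  ultimately have "orthogonal ?z ?z"
    by (rule orthogonal_to_span)
  then show ?thesis by (simp add: orthogonal_self)
qed

lemma singular_system_mult_vec:
  fixes A :: "real ^ 'c ^ 'r"
  assumes "singular_system A \<sigma> \<phi>"
  obtains \<psi> where "orthonormal_family (min CARD('r) CARD('c)) \<psi>"
    and "\<And>x. A *v x = (\<Sum>i = 1..min CARD('r) CARD('c). (\<sigma> i * (\<phi> i \<bullet> x)) *\<^sub>R \<psi> i)"
proof -
  obtain \<psi> where on: "orthonormal_family (min CARD('r) CARD('c)) \<psi>"
    and A: "A = (\<Sum>i = 1..min CARD('r) CARD('c). \<sigma> i *\<^sub>R outer (\<psi> i) (\<phi> i))"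
    using assms unfolding singular_system_def by blast
  have "A *v x = (\<Sum>i = 1..min CARD('r) CARD('c). (\<sigma> i * (\<phi> i \<bullet> x)) *\<^sub>R \<psi> i)" for x
    unfolding A
    by (simp only: sum_matrix_mult_vec scaleR_matrix_vector_assoc[symmetric] outer_mult_vec
        scaleR_scaleR)
  with on show thesis by (rule that)
qed

lemma inner_sum_orthonormal:
  assumes "orthonormal_family m \<psi>" and "j \<in> {1..m}"
  shows "\<psi> j \<bullet> (\<Sum>i = 1..m. a i *\<^sub>R \<psi> i) = a j"
proof -
  have "(\<Sum>i = 1..m. a i * (\<psi> j \<bullet> \<psi> i)) = (\<Sum>i = 1..m. if i = j then a i else 0)"
    using assms by (intro sum.cong) (auto simp: orthonormal_family_def)
  then show ?thesis using assms(2) by (simp add: inner_sum_right)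
qed

lemma singular_system_kernel:
  fixes A :: "real ^ 'c ^ 'r"
  assumes S: "singular_system A \<sigma> \<phi>" and "A *v x = 0" and j: "j \<in> {1..CARD('c)}" and "\<sigma> j > 0"
  shows "\<phi> j \<bullet> x = 0"
proof -
  obtain \<psi> where on: "orthonormal_family (min CARD('r) CARD('c)) \<psi>"
    and A: "\<And>x. A *v x = (\<Sum>i = 1..min CARD('r) CARD('c). (\<sigma> i * (\<phi> i \<bullet> x)) *\<^sub>R \<psi> i)"
    using singular_system_mult_vec[OF S] by blast
  \<comment> \<open>Singular values beyond the number of rows are zero, so \<open>\<psi> j\<close>
    belongs to the orthonormal left family and picks out the j-th coefficient.\<close>
  have "j \<le> CARD('r)"
    using S j \<open>\<sigma> j > 0\<close> unfolding singular_system_def by (metis less_irrefl not_le)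
  then have "\<psi> j \<bullet> (A *v x) = \<sigma> j * (\<phi> j \<bullet> x)"
    using j unfolding A by (intro inner_sum_orthonormal[OF on]) auto
  with assms show ?thesis by simp
qed

text \<open>Otherwise \<open>\<phi> j\<close> would be a kernel vector and therefore orthogonal to
  itself, although it has norm 1.\<close>

lemma singular_system_nonzero:
  fixes A :: "real ^ 'c ^ 'r"
  assumes S: "singular_system A \<sigma> \<phi>" and j: "j \<in> {1..CARD('c)}" and "\<sigma> j > 0"
  shows "A *v \<phi> j \<noteq> 0"
proof
  assume "A *v \<phi> j = 0"
  then have "\<phi> j \<bullet> \<phi> j = 0"
    using assms by (intro singular_system_kernel) auto
  moreover have "orthonormal_family CARD('c) \<phi>"
    using S by (simp add: singular_system_def)
  then have "\<phi> j \<bullet> \<phi> j = 1"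
    using j unfolding orthonormal_family_def by metis
  ultimately show False by simp
qed

subsection \<open>Marginals and the kernel of the canonical dependence matrix\<close>

lemma sum_pmf_PX: "(\<Sum>y\<in>UNIV. pmf P (x, y)) = PX P x"
  for P :: "('x::finite \<times> 'y::finite) pmf"
proof -
  have "PX P x = sum (pmf P) (fst -` {x})"
    by (simp add: PX_def pmf_map measure_measure_pmf_finite)
  also have "fst -` {x} = Pair x ` (UNIV :: 'y set)" by auto
  also have "sum (pmf P) \<dots> = (\<Sum>y\<in>UNIV. pmf P (x, y))"
    by (subst sum.reindex) (auto simp: inj_on_def)
  finally show ?thesis by simp
qed

lemma sum_pmf_PY: "(\<Sum>x\<in>UNIV. pmf P (x, y)) = PY P y"
  for P :: "('x::finite \<times> 'y::finite) pmf"
proof -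
  have "PY P y = sum (pmf P) (snd -` {y})"
    by (simp add: PY_def pmf_map measure_measure_pmf_finite)
  also have "snd -` {y} = (\<lambda>x. (x, y)) ` (UNIV :: 'x set)" by auto
  also have "sum (pmf P) \<dots> = (\<Sum>x\<in>UNIV. pmf P (x, y))"
    by (subst sum.reindex) (auto simp: inj_on_def)
  finally show ?thesis by simp
qed

lemma sum_PX: "(\<Sum>x\<in>UNIV. PX P x) = 1" for P :: "('x::finite \<times> 'y::finite) pmf"
  unfolding PX_def by (simp add: sum_pmf_eq_1)

section \<open>The kernel vector, the test vector and the images of the latter\<close>

definition sqrt_PX :: "('x::finite \<times> 'y::finite) pmf \<Rightarrow> real ^ 'x" where
  "sqrt_PX P = (\<chi> x. sqrt (PX P x))"

text \<open>With \<open>f x = u $ x / sqrt (PX P x)\<close> the entries are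
  \<open>sqrt (pmf P (x, y)) * f x\<close>: this is the random variable f(X), scaled so that its L2
  norm under \<open>P\<close> becomes the Euclidean norm.\<close>

definition test_vec :: "('x::finite \<times> 'y::finite) pmf \<Rightarrow> real ^ 'x \<Rightarrow> real ^ ('x \<times> 'y)" where
  "test_vec P u = (\<chi> p. sqrt (cond_prob_YX P (snd p) (fst p)) * u $ fst p)"

context
  fixes P :: "('x::finite \<times> 'y::finite) pmf"
  assumes PX_pos: "\<And>x. PX P x > 0" and PY_pos: "\<And>y. PY P y > 0"
begin

text \<open>The factor \<open>sqrt (PX P x)\<close> cancels, and joint minus product probabilities
  sum to zero over x.\<close>

lemma B_tilde_sqrt_PX: "B_tilde P *v sqrt_PX P = 0"
proof -
  have "(B_tilde P *v sqrt_PX P) $ y = 0" for y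
  proof -
    have "(B_tilde P *v sqrt_PX P) $ y
        = (\<Sum>x\<in>UNIV. (pmf P (x, y) - PX P x * PY P y) / sqrt (PY P y))"
      unfolding matrix_vector_mult_def B_tilde_def sqrt_PX_def
      using PX_pos by (auto simp: real_sqrt_mult less_imp_neq[symmetric] intro!: sum.cong)
    also have "\<dots> = 0"
      by (simp add: sum_divide_distrib[symmetric] sum_subtractf sum_pmf_PY
          sum_distrib_right[symmetric] sum_PX)
    finally show ?thesis .
  qed
  then show ?thesis by (simp add: vec_eq_iff)
qed

text \<open>The left block of \<open>L_bar\<close> is block diagonal in x with blocks
  \<open>I - r / (1 + r) * q q^T\<close>, where q is the unit vector of the
  \<open>sqrt (cond_prob_YX P y x)\<close>. On block x the test vector is a multiple of q, and
  \<open>1 - r / (1 + r) = 1 / (1 + r)\<close>. The zero padding removes the additional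
  columns.\<close>

lemma L_bar_test_vec:
  assumes "r \<ge> 0"
  shows "L_bar P r *v (\<chi> c. case c of Inl p \<Rightarrow> test_vec P u $ p | Inr x \<Rightarrow> 0)
    = (1 / (1 + r)) *\<^sub>R test_vec P u"
proof -
  have cond: "(\<Sum>y\<in>UNIV. cond_prob_YX P y x) = 1" for x
    using PX_pos[of x] by (simp add: cond_prob_YX_def sum_divide_distrib[symmetric] sum_pmf_PX)
  have nn: "cond_prob_YX P y x \<ge> 0" for x y
    using PX_pos[of x] by (simp add: cond_prob_YX_def)
  have "(L_bar P r *v (\<chi> c. case c of Inl p \<Rightarrow> test_vec P u $ p | Inr x \<Rightarrow> 0)) $ (x, y)
      = (1 / (1 + r)) * test_vec P u $ (x, y)" (is "?l = _") for x y
  proof -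
    let ?q = "\<lambda>y. sqrt (cond_prob_YX P y x)"
    have "?l = (\<Sum>x'\<in>UNIV. \<Sum>y'\<in>UNIV. (of_bool (x = x') * of_bool (y = y')
          - r / (1 + r) * sqrt (cond_prob_YX P y x * cond_prob_YX P y' x') * of_bool (x = x'))
            * (sqrt (cond_prob_YX P y' x') * u $ x'))"
      by (simp add: matrix_vector_mult_def UNIV_Plus_UNIV[symmetric] sum.Plus sum_UNIV_prod
          L_bar_def test_vec_def del: UNIV_Plus_UNIV)
    also have "\<dots> = (\<Sum>x'\<in>UNIV. if x' = x then \<Sum>y'\<in>UNIV. (of_bool (y = y')
          - r / (1 + r) * (?q y * ?q y')) * (?q y' * u $ x) else 0)"
      by (intro sum.cong) (auto simp: real_sqrt_mult)
    also have "\<dots> = (\<Sum>y'\<in>UNIV. (of_bool (y = y') - r / (1 + r) * (?q y * ?q y')) * (?q y' * u $ x))"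
      by simp
    also have "\<dots> = (\<Sum>y'\<in>UNIV. (if y' = y then ?q y' * u $ x else 0)
        - r / (1 + r) * ?q y * u $ x * cond_prob_YX P y' x)"
      using nn by (intro sum.cong) (auto simp: algebra_simps simp flip: power2_eq_square)
    also have "\<dots> = ?q y * u $ x - r / (1 + r) * ?q y * u $ x"
      by (simp only: sum_subtractf sum_distrib_left[symmetric] cond) simp
    also have "\<dots> = (1 / (1 + r)) * test_vec P u $ (x, y)"
      using assms by (simp add: test_vec_def field_simps)
    finally show ?thesis .
  qed
  then show ?thesis by (simp add: vec_eq_iff)
qed

text \<open>The two delta terms of \<open>L_mat\<close> turn f(X) into its conditional expectations
  given X = x and given Y = y. The first is \<open>f x\<close>, the second is an entry of
  \<open>B_tilde P *v u\<close> up to scaling.\<close>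

lemma L_mat_test_vec:
  assumes "sqrt_PX P \<bullet> u = 0"
  shows "(L_mat P *v test_vec P u) $ (x, y) =
    ((pmf P (x, y) - PX P x * PY P y) * (u $ x / sqrt (PX P x))
      - (pmf P (x, y) + PX P x * PY P y) * ((B_tilde P *v u) $ y / sqrt (PY P y)))
    / (2 * sqrt (PX P x * PY P y))"
proof -
  define f where "f = (\<lambda>x. u $ x / sqrt (PX P x))"
  define c where "c = pmf P (x, y) + PX P x * PY P y"
  have sq: "sqrt (PX P x) * sqrt (PX P x) = PX P x" "sqrt (PX P x) \<noteq> 0" for x
    using PX_pos[of x] by auto
  \<comment> \<open>Orthogonality to \<open>sqrt_PX P\<close> says that f(X) has mean zero.\<close>
  have Ef: "(\<Sum>x\<in>UNIV. PX P x * f x) = 0"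
  proof -
    have "PX P x * f x = sqrt (PX P x) * u $ x" for x
      using sq[of x] by (simp add: f_def field_simps)
    then show ?thesis using assms by (simp add: inner_vec_def sqrt_PX_def)
  qed
  \<comment> \<open>The left side is the conditional expectation of f(X) given Y = y; the product
    part of \<open>B_tilde\<close> contributes only the mean, which vanishes by
    \<open>Ef\<close>.\<close>
  have g: "(\<Sum>x\<in>UNIV. pmf P (x, y) * f x) / PY P y = (B_tilde P *v u) $ y / sqrt (PY P y)"
  proof -
    have "(B_tilde P *v u) $ y = (\<Sum>x\<in>UNIV. (pmf P (x, y) * f x - PY P y * (PX P x * f x)) / sqrt (PY P y))"
      unfolding matrix_vector_mult_def B_tilde_def f_def
      by (simp add: real_sqrt_mult algebra_simps diff_divide_distrib)
    also have "\<dots> = (\<Sum>x\<in>UNIV. pmf P (x, y) * f x) / sqrt (PY P y)"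
      by (simp add: sum_divide_distrib[symmetric] sum_subtractf sum_distrib_left[symmetric] Ef)
    finally show ?thesis using PY_pos[of y] by simp
  qed
  have tv: "test_vec P u $ (x', y') = sqrt (pmf P (x', y')) * f x'" for x' y'
    by (simp add: test_vec_def cond_prob_YX_def f_def real_sqrt_divide)
  have "(L_mat P *v test_vec P u) $ (x, y) = (\<Sum>x'\<in>UNIV. \<Sum>y'\<in>UNIV.
      ((if x' = x then if y' = y then pmf P (x, y) * f x else 0 else 0)
       - c / 2 * ((if x' = x then pmf P (x, y') * f x / PX P x else 0)
         + (if y' = y then pmf P (x', y) * f x' / PY P y else 0))) / sqrt (PX P x * PY P y))"
    unfolding matrix_vector_mult_def
    by (auto simp: sum_UNIV_prod L_mat_def tv c_def real_sqrt_divide field_simps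
        intro!: sum.cong)
  also have "\<dots> = (pmf P (x, y) * f x - c / 2 * (f x + (\<Sum>x'\<in>UNIV. pmf P (x', y) * f x') / PY P y))
       / sqrt (PX P x * PY P y)"
  proof -
    have "(\<Sum>x'\<in>UNIV. \<Sum>y'\<in>UNIV. if x' = x then pmf P (x, y') * f x / PX P x else 0)
        = (\<Sum>x'\<in>UNIV. if x' = x then (\<Sum>y'\<in>UNIV. pmf P (x, y')) * f x / PX P x else 0)"
      by (intro sum.cong) (auto simp: sum_distrib_right sum_divide_distrib)
    also have "\<dots> = f x" using PX_pos[of x] by (simp add: sum_pmf_PX)
    finally have 1: "(\<Sum>x'\<in>UNIV. \<Sum>y'\<in>UNIV. if x' = x then pmf P (x, y') * f x / PX P x else 0) = f x" .
    have "(\<Sum>x'\<in>UNIV. \<Sum>y'\<in>UNIV. if x' = x then if y' = y then pmf P (x, y) * f x else 0 else 0)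
        = (\<Sum>x'\<in>UNIV. if x' = x then (\<Sum>y'\<in>UNIV. if y' = y then pmf P (x, y) * f x else 0) else 0)"
      by (intro sum.cong) auto
    then have 2: "(\<Sum>x'\<in>UNIV. \<Sum>y'\<in>UNIV. if x' = x then if y' = y then pmf P (x, y) * f x else 0 else 0)
        = pmf P (x, y) * f x" by simp
    show ?thesis
      by (simp add: sum_divide_distrib[symmetric] sum_subtractf sum_distrib_left[symmetric]
          sum.distrib 1 2)
  qed
  \<comment> \<open>The coefficient of \<open>f x\<close> combines to half of
    \<open>2 * pmf P (x, y) - c\<close>, which is the joint minus the product probability.\<close>
  finally show ?thesis
    unfolding g using PX_pos[of x] PY_pos[of y] by (simp add: c_def f_def field_simps)
qed

text \<open>Pairing cancels the square roots in the denominator. For fixed y, with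
  \<open>g y\<close> the conditional expectation of f(X), the sum over x gives
  \<open>PY P y * g y\<close> from the difference and \<open>2 * PY P y * g y\<close> from the sum
  of joint and product probabilities, so a negative square remains.\<close>

lemma kron_L_mat_test_vec:
  assumes "sqrt_PX P \<bullet> u = 0"
  shows "kron_vec (sqrt_PX P) (B_tilde P *v u) \<bullet> (L_mat P *v test_vec P u)
    = - (norm (B_tilde P *v u))\<^sup>2 / 2"
proof -
  let ?b = "B_tilde P *v u"
  define f where "f = (\<lambda>x. u $ x / sqrt (PX P x))"
  define g where "g = (\<lambda>y. ?b $ y / sqrt (PY P y))"
  have b: "?b $ y = sqrt (PY P y) * g y" for y
    using PY_pos[of y] by (simp add: g_def)
  have row: "(\<Sum>x\<in>UNIV. (pmf P (x, y) - PX P x * PY P y) * f x) = PY P y * g y" for y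
  proof -
    have "?b $ y = (\<Sum>x\<in>UNIV. (pmf P (x, y) - PX P x * PY P y) * f x / sqrt (PY P y))"
      unfolding matrix_vector_mult_def B_tilde_def f_def
      using PX_pos PY_pos by (auto simp: real_sqrt_mult field_simps intro!: sum.cong)
    then show ?thesis
      using PY_pos[of y] by (simp add: b sum_divide_distrib[symmetric] field_simps)
  qed
  have sq: "sqrt (PX P x) \<noteq> 0" "sqrt (PY P y) \<noteq> 0" for x y
    using PX_pos[of x] PY_pos[of y] by auto
  have "kron_vec (sqrt_PX P) ?b \<bullet> (L_mat P *v test_vec P u)
      = (\<Sum>x\<in>UNIV. \<Sum>y\<in>UNIV. g y / 2 * ((pmf P (x, y) - PX P x * PY P y) * f x
          - (pmf P (x, y) + PX P x * PY P y) * g y))"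
    unfolding inner_vec_def sum_UNIV_prod L_mat_test_vec[OF assms] f_def[symmetric]
    by (intro sum.cong refl) (use sq in \<open>simp add: kron_vec_def sqrt_PX_def b real_sqrt_mult f_def\<close>)
  \<comment> \<open>Summing over x first makes \<open>row\<close> applicable.\<close>
  also have "\<dots> = (\<Sum>y\<in>UNIV. \<Sum>x\<in>UNIV. g y / 2 * ((pmf P (x, y) - PX P x * PY P y) * f x
          - (pmf P (x, y) + PX P x * PY P y) * g y))"
    by (rule sum.swap)
  also have "\<dots> = (\<Sum>y\<in>UNIV. g y / 2 * (PY P y * g y - 2 * PY P y * g y))"
    by (simp only: sum_distrib_left[symmetric] sum_subtractf row sum_distrib_right[symmetric]
        sum.distrib sum_pmf_PY sum_PX) simp
  also have "\<dots> = - (\<Sum>y\<in>UNIV. ?b $ y * ?b $ y) / 2"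
    using PY_pos by (simp add: b sum_negf[symmetric] sum_divide_distrib less_imp_le
        real_sqrt_mult_self algebra_simps)
  finally show ?thesis
    by (simp add: power2_norm_eq_inner inner_vec_def)
qed

subsection \<open>Positivity of the spectral norm\<close>

text \<open>The gap makes all weights in \<open>G_mat\<close> positive, so its congruence by
  \<open>L_bar\<close> has a nonnegative quadratic form. One vector with a positive value shows that
  the matrix is nonzero, hence so is its norm.\<close>

lemma alpha_bar_pos:
  assumes S: "singular_system (B_tilde P) \<sigma> \<phi>"
    and k: "k \<in> {1..CARD('x) - 1}" and gap: "\<sigma> k > \<sigma> (k + 1)" and r: "r \<ge> 0"
  shows "alpha_bar P \<sigma> \<phi> k r > 0"
proof -
  let ?d = "CARD('x)" and ?B = "B_tilde P" and ?s = "sqrt_PX P"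
  have kd: "1 \<le> k" "k + 1 \<le> ?d" using k by auto
  have nonneg: "0 \<le> \<sigma> i" if "i \<in> {1..?d}" for i
    using S that by (auto simp: singular_system_def)
  have mono: "\<sigma> j \<le> \<sigma> i" if "i \<in> {1..?d}" "j \<in> {1..?d}" "i \<le> j" for i j
    using S that by (auto simp: singular_system_def)
  have pos: "\<sigma> i > \<sigma> j" "\<sigma> j \<ge> 0" if "i \<in> {1..k}" "j \<in> {k+1..?d}" for i j
    using mono[of i k] mono[of "k+1" j] nonneg[of j] gap k that by auto
  \<comment> \<open>Since \<open>k + 1\<close> is at most the number of columns,
    \<open>\<sigma> (k + 1)\<close> is nonnegative and lies strictly below.\<close>
  have pos': "\<sigma> i > 0" if "i \<in> {1..k}" for i
    using pos[of i "k+1"] kd that by auto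
  have orth: "\<phi> i \<bullet> ?s = 0" if "i \<in> {1..k}" for i
    using singular_system_kernel[OF S B_tilde_sqrt_PX, of i] pos'[OF that] k that by auto
  have "?s = (\<Sum>j = 1..?d. (\<phi> j \<bullet> ?s) *\<^sub>R \<phi> j)"
    using S by (intro orthonormal_expansion) (simp add: singular_system_def)
  also have "\<dots> = (\<Sum>j = k+1..?d. (\<phi> j \<bullet> ?s) *\<^sub>R \<phi> j)"
  proof (rule sum.mono_neutral_right)
    show "\<forall>i\<in>{1..?d} - {k+1..?d}. (\<phi> i \<bullet> ?s) *\<^sub>R \<phi> i = 0"
      using orth by auto
  qed auto
  finally have exp_s: "?s = (\<Sum>j = k+1..?d. (\<phi> j \<bullet> ?s) *\<^sub>R \<phi> j)" .
  \<comment> \<open>This linear map sends \<open>\<phi> j\<close> to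
    \<open>theta P \<phi> 1 j\<close>, which carries the expansion of \<open>?s\<close> over to the
    theta vectors.\<close>
  have lin: "linear (\<lambda>a. kron_vec a (?B *v \<phi> 1) + kron_vec (\<phi> 1) (?B *v a))"
    by (rule linearI) (simp_all add: vec_eq_iff kron_vec_def matrix_vector_right_distrib
        matrix_vector_mult_scaleR algebra_simps)
  \<comment> \<open>The added summand vanishes because \<open>?s\<close> is in the kernel; it
    completes the value of the linear map at \<open>?s\<close>.\<close>
  have "kron_vec ?s (?B *v \<phi> 1) = kron_vec ?s (?B *v \<phi> 1) + kron_vec (\<phi> 1) (?B *v ?s)"
    by (simp add: B_tilde_sqrt_PX kron_vec_def vec_eq_iff)
  also have "\<dots> = (\<Sum>j = k+1..?d. (\<phi> j \<bullet> ?s) *\<^sub>R theta P \<phi> 1 j)"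
    unfolding theta_def
    by (subst (1 2) exp_s) (simp only: linear_sum[OF lin] linear_cmul[OF lin])
  finally have kron: "kron_vec ?s (?B *v \<phi> 1) = (\<Sum>j = k+1..?d. (\<phi> j \<bullet> ?s) *\<^sub>R theta P \<phi> 1 j)" .
  \<comment> \<open>As \<open>L_mat\<close> is the outer factor of \<open>G_mat\<close>, the form of
    \<open>G_mat\<close> at the test vector is that of the inner sum \<open>K\<close> at
    \<open>w\<close>.\<close>
  define w where "w = L_mat P *v test_vec P (\<phi> 1)"
  have "kron_vec ?s (?B *v \<phi> 1) \<bullet> w \<noteq> 0"
    unfolding w_def using orth[of 1] pos'[of 1] k singular_system_nonzero[OF S, of 1]
    by (subst kron_L_mat_test_vec) (auto simp: inner_commute)
  then have "\<exists>j\<in>{k+1..?d}. theta P \<phi> 1 j \<bullet> w \<noteq> 0"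
    unfolding kron inner_sum_left by (force elim: sum.not_neutral_contains_not_neutral)
  then obtain l where l: "l \<in> {k+1..?d}" "theta P \<phi> 1 l \<bullet> w \<noteq> 0" by blast
  define K where "K = (\<Sum>i = 1..k. \<Sum>j = k + 1..?d.
      (1 / ((\<sigma> i)\<^sup>2 - (\<sigma> j)\<^sup>2)) *\<^sub>R outer (theta P \<phi> i j) (theta P \<phi> i j))"
  have form: "z \<bullet> (K *v z) = (\<Sum>i = 1..k. \<Sum>j = k+1..?d. (theta P \<phi> i j \<bullet> z)\<^sup>2 / ((\<sigma> i)\<^sup>2 - (\<sigma> j)\<^sup>2))" for z
    unfolding K_def sum_matrix_mult_vec scaleR_matrix_vector_assoc[symmetric] outer_mult_vec
    by (simp add: inner_sum_right inner_commute power2_eq_square)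
  have summand: "(theta P \<phi> i j \<bullet> w)\<^sup>2 / ((\<sigma> i)\<^sup>2 - (\<sigma> j)\<^sup>2) \<ge> 0"
    if "i \<in> {1..k}" "j \<in> {k+1..?d}" for i j
    using pos[OF that] by (simp add: power_mono)
  \<comment> \<open>All terms are nonnegative, so strictness of the single term with indices 1 and
    \<open>l\<close> suffices.\<close>
  have "w \<bullet> (K *v w) > 0"
    unfolding form
  proof (rule sum_pos2[of _ 1])
    show "0 < (\<Sum>j = k+1..?d. (theta P \<phi> 1 j \<bullet> w)\<^sup>2 / ((\<sigma> 1)\<^sup>2 - (\<sigma> j)\<^sup>2))"
    proof (rule sum_pos2[of _ l])
      show "0 < (theta P \<phi> 1 l \<bullet> w)\<^sup>2 / ((\<sigma> 1)\<^sup>2 - (\<sigma> l)\<^sup>2)"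
        using l pos[of 1 l] k by (simp add: power_strict_mono)
    qed (use l k summand in auto)
  qed (use k summand in \<open>auto intro!: sum_nonneg\<close>)
  moreover define v :: "real ^ ('x \<times> 'y + 'x)"
    where "v = (\<chi> c. case c of Inl p \<Rightarrow> test_vec P (\<phi> 1) $ p | Inr x \<Rightarrow> 0)"
  let ?M = "transpose (L_bar P r) ** G_mat P \<sigma> \<phi> k ** L_bar P r"
  have "L_mat P *v (L_bar P r *v v) = (1 / (1 + r)) *\<^sub>R w"
    unfolding v_def L_bar_test_vec[OF r] by (simp only: w_def matrix_vector_mult_scaleR)
  then have "v \<bullet> (?M *v v) = ((1 / (1 + r)) *\<^sub>R w) \<bullet> (K *v ((1 / (1 + r)) *\<^sub>R w))"
    by (simp only: inner_congruence G_mat_def K_def[symmetric])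
  then have "v \<bullet> (?M *v v) = (1 / (1 + r))\<^sup>2 * (w \<bullet> (K *v w))"
    by (simp only: matrix_vector_mult_scaleR inner_scaleR_left inner_scaleR_right power2_eq_square
        mult.assoc)
  ultimately have "v \<bullet> (?M *v v) > 0" using r by simp
  then have "?M *v v \<noteq> 0" by force
  then show ?thesis
    unfolding alpha_bar_def spectral_norm_def
    by (subst onorm_pos_lt) (auto intro: matrix_vector_mul_bounded_linear)
qed

end

subsection \<open>Optimal allocation of the budget\<close>

text \<open>Along each ray of fixed ratio the exponent grows linearly in the number of labeled
  samples, so only budget-exhausting points compete, and there it is a positive constant divided by
  \<open>H r\<close>. The equivalence asserts neither existence nor uniqueness of a
  minimiser.\<close>

lemma optimal_allocation:
  fixes \<alpha> :: "real \<Rightarrow> real"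
  assumes pos: "\<And>r. r \<ge> 0 \<Longrightarrow> \<alpha> r > 0"
    and "\<epsilon> > 0" "Cl > 0" "Cu > 0" "C > 0"
  shows "is_arg_max (\<lambda>(nl, nu). \<epsilon> * nl / (2 * \<alpha> (nu / nl))) (within_budget Cl Cu C) (nl, nu) \<longleftrightarrow>
    (\<exists>r. is_arg_min (\<lambda>r. (Cl + r * Cu) * \<alpha> r) (\<lambda>r. 0 \<le> r) r \<and>
         nl = C / (Cl + r * Cu) \<and> nu = r * C / (Cl + r * Cu))"
proof -
  define F where "F = (\<lambda>(nl, nu). \<epsilon> * nl / (2 * \<alpha> (nu / nl)))"
  define H where "H = (\<lambda>r. (Cl + r * Cu) * \<alpha> r)"
  \<comment> \<open>\<open>a r\<close> is the point of ratio r that spends exactly the whole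
    budget.\<close>
  define a where "a = (\<lambda>r. (C / (Cl + r * Cu), r * C / (Cl + r * Cu)))"
  have cost: "Cl + r * Cu > 0" if "r \<ge> 0" for r
    using that assms by (simp add: add_pos_nonneg)
  have H_pos: "H r > 0" if "r \<ge> 0" for r
    using that cost pos by (simp add: H_def)
  have feasible: "within_budget Cl Cu C (a r)" if "r \<ge> 0" for r
  proof -
    have "C / (Cl + r * Cu) * Cl + r * C / (Cl + r * Cu) * Cu = C * (Cl + r * Cu) / (Cl + r * Cu)"
      by (simp add: add_divide_distrib algebra_simps)
    then show ?thesis
      using cost[OF that] that assms by (simp add: within_budget_def a_def)
  qed
  have F_a: "F (a r) = \<epsilon> * C / 2 / H r" if "r \<ge> 0" for r
    using cost[OF that] assms by (simp add: F_def a_def H_def)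
  \<comment> \<open>Moving a feasible point along its ray to the budget line never lowers the
    exponent, and leaves it unchanged only if the point was already there.\<close>
  have upper: "0 \<le> m / n" "F (n, m) \<le> F (a (m / n))" "F (n, m) = F (a (m / n)) \<Longrightarrow> (n, m) = a (m / n)"
    if "within_budget Cl Cu C (n, m)" for n m
  proof -
    have nm: "n > 0" "m \<ge> 0" "n * Cl + m * Cu \<le> C"
      using that by (auto simp: within_budget_def)
    show r: "0 \<le> m / n" using nm by simp
    let ?r = "m / n"
    have n_le: "n \<le> C / (Cl + ?r * Cu)"
      using cost[OF r] nm by (simp add: pos_le_divide_eq algebra_simps)
    have F: "F (n, m) = \<epsilon> / (2 * \<alpha> ?r) * n" by (simp add: F_def)
    have F': "F (a ?r) = \<epsilon> / (2 * \<alpha> ?r) * (C / (Cl + ?r * Cu))"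
      unfolding F_a[OF r] H_def by simp
    have c: "\<epsilon> / (2 * \<alpha> ?r) > 0" using assms pos[OF r] by simp
    show "F (n, m) \<le> F (a ?r)"
      unfolding F F' using c n_le by (intro mult_left_mono) auto
    show "(n, m) = a ?r" if "F (n, m) = F (a ?r)"
    proof -
      have n: "n = C / (Cl + ?r * Cu)"
        using that c unfolding F F' by (metis mult_left_cancel less_irrefl)
      have "m = ?r * n" using nm by simp
      with n have "m = ?r * C / (Cl + ?r * Cu)" by (metis times_divide_eq_right)
      with n show ?thesis by (simp add: a_def)
    qed
  qed
  have F_less: "F (a r) < F (a r') \<longleftrightarrow> H r' < H r" if "r \<ge> 0" "r' \<ge> 0" for r r'
    unfolding F_a[OF that(1)] F_a[OF that(2)]
    using H_pos[OF that(1)] H_pos[OF that(2)] assms by (simp add: field_simps)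
  have "is_arg_max F (within_budget Cl Cu C) (nl, nu) \<longleftrightarrow>
      (\<exists>r. is_arg_min H (\<lambda>r. 0 \<le> r) r \<and> (nl, nu) = a r)"
  proof
    assume max: "is_arg_max F (within_budget Cl Cu C) (nl, nu)"
    then have w: "within_budget Cl Cu C (nl, nu)" by (simp add: is_arg_max_def)
    note up = upper[OF w]
    have le: "\<not> F (nl, nu) < F (a r)" if "r \<ge> 0" for r
      using max feasible[OF that] unfolding is_arg_max_def by blast
    \<comment> \<open>The maximiser is not beaten by the point of the budget line on its own ray, so
      the equality case of \<open>upper\<close> applies.\<close>
    have eq: "(nl, nu) = a (nu / nl)"
      using le[OF up(1)] up(2) by (intro up(3)) simp
    moreover have "is_arg_min H (\<lambda>r. 0 \<le> r) (nu / nl)"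
      unfolding is_arg_min_def using up(1) le F_less[OF up(1)] eq by metis
    ultimately show "\<exists>r. is_arg_min H (\<lambda>r. 0 \<le> r) r \<and> (nl, nu) = a r" by blast
  next
    assume "\<exists>r. is_arg_min H (\<lambda>r. 0 \<le> r) r \<and> (nl, nu) = a r"
    then obtain r where r: "is_arg_min H (\<lambda>r. 0 \<le> r) r" "(nl, nu) = a r" by blast
    then have r0: "r \<ge> 0" by (simp add: is_arg_min_def)
    \<comment> \<open>\<open>F (n, m)\<close> is at most \<open>F (a (m / n))\<close>, which does
      not exceed \<open>F (a r)\<close> because r minimises \<open>H\<close>.\<close>
    have "\<not> F (a r) < F (n, m)" if "within_budget Cl Cu C (n, m)" for n m
      using upper(1,2)[OF that] F_less[OF r0] r(1)
      by (metis is_arg_min_def order_less_le_trans)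
    then show "is_arg_max F (within_budget Cl Cu C) (nl, nu)"
      using feasible[OF r0] r(2) by (auto simp: is_arg_max_def)
  qed
  then show ?thesis by (simp add: F_def H_def a_def)
qed

theorem proposition4:
  fixes P :: "('x::finite \<times> 'y::finite) pmf"
    and \<sigma> :: "nat \<Rightarrow> real"
    and \<phi> :: "nat \<Rightarrow> real ^ 'x"
    and k :: nat
    and \<epsilon> Cl Cu C nl nu :: real
  assumes "\<And>x. PX P x > 0"
    and "\<And>y. PY P y > 0"
    and "singular_system (B_tilde P) \<sigma> \<phi>"
    and "k \<in> {1..CARD('x) - 1}"
    and "\<sigma> k > \<sigma> (k + 1)"
    and "\<epsilon> > 0"
    and "Cl > 0" and "Cu > 0" and "C > 0"
  shows "is_arg_max (error_exponent P \<sigma> \<phi> k \<epsilon>) (within_budget Cl Cu C) (nl, nu) \<longleftrightarrow>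
    (\<exists>r. is_arg_min (\<lambda>r. (Cl + r * Cu) * alpha_bar P \<sigma> \<phi> k r) (\<lambda>r. 0 \<le> r) r \<and>
         nl = C / (Cl + r * Cu) \<and> nu = r * C / (Cl + r * Cu))"
  unfolding error_exponent_def
  using alpha_bar_pos[OF assms(1-5)] assms(6-9) by (rule optimal_allocation)

end
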